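(* Let $K:S^1\to\mathbb R^2$, $\varphi\mapsto Y(\varphi)$, be a positively oriented regular $C^k$ curve, $k\ge2$, with non-vanishing curvature, and let $f\in C^k(S^1,S^1)$ be a torsion map with $f^0=f^n=\mathrm{id}_{S^1}$, $n\ge2$. Define $$s=-\frac{\langle Y',J(Y\circ f-Y)\rangle}{\langle(Y\circ f-Y)',J(Y\circ f-Y)\rangle},\qquad X=Y+s\,(Y\circ f-Y).$$ 1. Whenever $s$ has no singularities (i.e. the denominator of $s$ has no zeros), the pair $(K,C)$, where the envelope $C\in C^{k-1}(S^1,\mathbb R^2)$ is given by $\varphi\mapsto X(\varphi)$, is a Poncelet pair. 2. If, in the situation of item 1, $k\ge3$ and the curvature of $C$ does not vanish, then $C$ is a regular curve. 3. If $K$ has no self-intersections (and $k\ge2$), then the function $s$ is well-defined and satisfies $0<s<1$, i.e. the points of contact of the Poncelet polygon with the envelope $C$ lie inside the sides.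
   Context: Here $S^1=\mathbb R/2\pi\mathbb Z$, $\langle\cdot,\cdot\rangle$ is the Euclidean inner product, and $J=\begin{pmatrix}0&-1\\1&0\end{pmatrix}$. Torsion map: an orientation preserving diffeomorphism $f:S^1\to S^1$ (here with $f$ and $f^{-1}$ of class $C^k$) such that $f^n=\mathrm{id}_{S^1}$ and $f^i\ne\mathrm{id}_{S^1}$ for $0<i<n$, where $f^i$ is the $i$-th iterate. Poncelet pair: closed curves $(K,C)$ such that every point of $K$ is a vertex of an $n$-gon $P$ (a Poncelet polygon) inscribed in $K$ and circumscribed about $C$; circumscribed also allows that prolongations of the sides of $P$ are tangential to $C$. Here the Poncelet polygon starting at $Y(\varphi)$ has vertices $Y(\varphi),Y(f(\varphi)),\ldots,Y(f^{n-1}(\varphi))$, with sides joining $Y(f^i(\varphi))$ and $Y(f^{i+1}(\varphi))$, $i$ mod $n$. $C$ is the envelope of the lines through $Y(\varphi)$ and $Y(f(\varphi))$: tangency to $C$ at $X(\varphi)$ means that $X(\varphi)$ lies on this line and $X'(\varphi)$ is parallel to $Y(f(\varphi))-Y(\varphi)$ (where $X'(\varphi)=0$ is allowed). "The curvature of $C$ does not vanish" means $\langle X'',JX'\rangle\neq0$ everywhere. *)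

theory Defs
  imports "HOL-Analysis.Analysis"
begin

quotient_type circle = real / "\<lambda>x y. \<exists>m::int. y = x + 2 * pi * of_int m"
  morphisms circle_rep to_circle
proof (rule equivpI)
  show "reflp (\<lambda>x y. \<exists>m::int. y = x + 2 * pi * of_int m)"
    by (rule reflpI) (rule exI[of _ 0], simp)
  show "symp (\<lambda>x y. \<exists>m::int. y = x + 2 * pi * of_int m)"
  proof (rule sympI)
    fix x y :: real assume "\<exists>m::int. y = x + 2 * pi * of_int m"
    then obtain m :: int where "y = x + 2 * pi * of_int m" by blast
    then have "x = y + 2 * pi * of_int (- m)" by simp
    then show "\<exists>m::int. x = y + 2 * pi * of_int m" by blast
  qed
  show "transp (\<lambda>x y. \<exists>m::int. y = x + 2 * pi * of_int m)"
  proof (rule transpI)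
    fix x y z :: real
    assume "\<exists>m::int. y = x + 2 * pi * of_int m" "\<exists>m::int. z = y + 2 * pi * of_int m"
    then obtain m n :: int where "y = x + 2 * pi * of_int m" "z = y + 2 * pi * of_int n" by blast
    then have "z = x + 2 * pi * of_int (m + n)" by (simp add: algebra_simps)
    then show "\<exists>m::int. z = x + 2 * pi * of_int m" by blast
  qed
qed

lemma to_circle_eq_iff:
  "to_circle x = to_circle y \<longleftrightarrow> (\<exists>m::int. y = x + 2 * pi * of_int m)"
  by (rule circle.abs_eq_iff)

lemma to_circle_rep [simp]: "to_circle (circle_rep p) = p"
  by (rule Quotient3_abs_rep[OF Quotient3_circle])

fun Ck :: "nat \<Rightarrow> (real \<Rightarrow> 'a::real_normed_vector) \<Rightarrow> bool" where
  "Ck 0 g \<longleftrightarrow> continuous_on UNIV g"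
| "Ck (Suc k) g \<longleftrightarrow> (\<forall>t. g differentiable at t) \<and> Ck k (\<lambda>t. vector_derivative g (at t))"

text \<open>The derivative with respect to the angle; the choice of the representative is
  immaterial, see \<open>circle_deriv_to_circle\<close>.\<close>

definition circle_deriv :: "(circle \<Rightarrow> 'a::real_normed_vector) \<Rightarrow> circle \<Rightarrow> 'a" where
  "circle_deriv Y p = vector_derivative (\<lambda>t. Y (to_circle t)) (at (circle_rep p))"

lemma circle_deriv_to_circle:
  "circle_deriv Y (to_circle t) = vector_derivative (\<lambda>u. Y (to_circle u)) (at t)"
proof -
  obtain m :: int where m: "circle_rep (to_circle t) = t + 2 * pi * of_int m"
    using to_circle_eq_iff[of t "circle_rep (to_circle t)"] by auto
  let ?g = "\<lambda>u. Y (to_circle u)" and ?c = "2 * pi * of_int m :: real"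
  have per: "to_circle (u + ?c) = to_circle u" for u
    using to_circle_eq_iff[of u "u + ?c"] by auto
  have "(?g has_vector_derivative d) (at (t + ?c)) \<longleftrightarrow> (?g has_vector_derivative d) (at t)" for d
  proof
    assume "(?g has_vector_derivative d) (at (t + ?c))"
    then have "((?g \<circ> (\<lambda>u. u + ?c)) has_vector_derivative (1 *\<^sub>R d)) (at t)"
      by (intro vector_diff_chain_at) (auto intro!: derivative_eq_intros)
    then show "(?g has_vector_derivative d) (at t)" by (simp add: o_def per)
  next
    assume "(?g has_vector_derivative d) (at t)"
    then have "(?g has_vector_derivative d) (at ((t + ?c) - ?c))" by simp
    then have "((?g \<circ> (\<lambda>u. u - ?c)) has_vector_derivative (1 *\<^sub>R d)) (at (t + ?c))"
      by (intro vector_diff_chain_at) (auto intro!: derivative_eq_intros)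
    moreover have "to_circle (u - ?c) = to_circle u" for u
      using per[of "u - ?c"] by simp
    ultimately show "(?g has_vector_derivative d) (at (t + ?c))" by (simp add: o_def)
  qed
  then show ?thesis
    unfolding circle_deriv_def m vector_derivative_def by simp
qed

definition Ck_curve :: "nat \<Rightarrow> (circle \<Rightarrow> 'a::real_normed_vector) \<Rightarrow> bool" where
  "Ck_curve k Y \<longleftrightarrow> Ck k (\<lambda>t. Y (to_circle t))"

text \<open>Regularity and orientation of a map of the circle are read off from a lift to the
  universal cover.\<close>

definition Ck_circle_map :: "nat \<Rightarrow> (circle \<Rightarrow> circle) \<Rightarrow> bool" where
  "Ck_circle_map k f \<longleftrightarrow> (\<exists>F. Ck k F \<and> (\<forall>t. f (to_circle t) = to_circle (F t)))"

definition orientation_preserving :: "(circle \<Rightarrow> circle) \<Rightarrow> bool" where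
  "orientation_preserving f \<longleftrightarrow>
     (\<exists>F. continuous_on UNIV F \<and> strict_mono F \<and> (\<forall>t. f (to_circle t) = to_circle (F t)))"

definition torsion_map :: "nat \<Rightarrow> nat \<Rightarrow> (circle \<Rightarrow> circle) \<Rightarrow> bool" where
  "torsion_map k n f \<longleftrightarrow>
     bij f \<and> Ck_circle_map k f \<and> Ck_circle_map k (inv f) \<and> orientation_preserving f \<and>
     f ^^ n = id \<and> (\<forall>i. 0 < i \<and> i < n \<longrightarrow> f ^^ i \<noteq> id)"

definition Jmat :: "real^2^2" where
  "Jmat = vector [vector [0, -1], vector [1, 0]]"

definition regular_curve :: "nat \<Rightarrow> (circle \<Rightarrow> real^2) \<Rightarrow> bool" where
  "regular_curve k Y \<longleftrightarrow> Ck_curve k Y \<and> (\<forall>p. circle_deriv Y p \<noteq> 0)"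

definition curvature_numerator :: "(circle \<Rightarrow> real^2) \<Rightarrow> circle \<Rightarrow> real" where
  "curvature_numerator Y p = circle_deriv (circle_deriv Y) p \<bullet> (Jmat *v circle_deriv Y p)"

definition nonvanishing_curvature :: "(circle \<Rightarrow> real^2) \<Rightarrow> bool" where
  "nonvanishing_curvature Y \<longleftrightarrow> (\<forall>p. curvature_numerator Y p \<noteq> 0)"

text \<open>Curves may intersect themselves, so positive orientation means a positive turning number.
  The integral below is the total signed curvature: the signed curvature is
  \<open>curvature_numerator / norm Y'^3\<close> and the element of arc length is \<open>norm Y'\<close>.\<close>

definition positively_oriented :: "(circle \<Rightarrow> real^2) \<Rightarrow> bool" where
  "positively_oriented Y \<longleftrightarrow>
     0 < integral {0..2 * pi}
           (\<lambda>t. curvature_numerator Y (to_circle t) / (norm (circle_deriv Y (to_circle t)))\<^sup>2)"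

text \<open>The line through \<open>a\<close> and \<open>b\<close> (possibly outside the segment) touches the curve \<open>X\<close> at the
  parameter \<open>p\<close>; cusps \<open>X' = 0\<close> are allowed.\<close>

definition line_tangent_at :: "(circle \<Rightarrow> real^2) \<Rightarrow> circle \<Rightarrow> real^2 \<Rightarrow> real^2 \<Rightarrow> bool" where
  "line_tangent_at X p a b \<longleftrightarrow>
     a \<noteq> b \<and> X p \<in> affine hull {a, b} \<and> (\<exists>c. circle_deriv X p = c *\<^sub>R (b - a))"

text \<open>The vertices of the \<open>n\<close>-gon inscribed in \<open>Y\<close> are given by \<open>n\<close> distinct parameters
  \<open>q 0, \<dots>, q (n - 1)\<close>. Two non-adjacent vertices may coincide at a self-intersection of \<open>Y\<close>.\<close>

definition poncelet_polygon ::
    "nat \<Rightarrow> (circle \<Rightarrow> real^2) \<Rightarrow> (circle \<Rightarrow> real^2) \<Rightarrow> (nat \<Rightarrow> circle) \<Rightarrow> bool" where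
  "poncelet_polygon n Y X q \<longleftrightarrow>
     inj_on q {..<n} \<and> (\<forall>i<n. \<exists>p. line_tangent_at X p (Y (q i)) (Y (q (Suc i mod n))))"

definition poncelet_pair :: "nat \<Rightarrow> (circle \<Rightarrow> real^2) \<Rightarrow> (circle \<Rightarrow> real^2) \<Rightarrow> bool" where
  "poncelet_pair n Y X \<longleftrightarrow>
     Ck_curve 1 Y \<and> Ck_curve 1 X \<and>
     (\<forall>z \<in> range Y. \<exists>q. poncelet_polygon n Y X q \<and> (\<exists>i<n. Y (q i) = z))"

definition chord :: "(circle \<Rightarrow> real^2) \<Rightarrow> (circle \<Rightarrow> circle) \<Rightarrow> circle \<Rightarrow> real^2" where
  "chord Y f p = Y (f p) - Y p"

definition contact_denom :: "(circle \<Rightarrow> real^2) \<Rightarrow> (circle \<Rightarrow> circle) \<Rightarrow> circle \<Rightarrow> real" where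
  "contact_denom Y f p = circle_deriv (chord Y f) p \<bullet> (Jmat *v chord Y f p)"

definition contact_param :: "(circle \<Rightarrow> real^2) \<Rightarrow> (circle \<Rightarrow> circle) \<Rightarrow> circle \<Rightarrow> real" where
  "contact_param Y f p = - ((circle_deriv Y p \<bullet> (Jmat *v chord Y f p)) / contact_denom Y f p)"

definition envelope :: "(circle \<Rightarrow> real^2) \<Rightarrow> (circle \<Rightarrow> circle) \<Rightarrow> circle \<Rightarrow> real^2" where
  "envelope Y f p = Y p + contact_param Y f p *\<^sub>R chord Y f p"

end

theory Submission
  imports Defs
begin

text \<open>Write \<open>c = Y \<circ> f - Y\<close> for the chord. Since \<open>s\<close> solves \<open>\<langle>Y' + s c', J c\<rangle> = 0\<close>, the
  derivative of \<open>X = Y + s c\<close> is orthogonal to \<open>J c\<close>, hence parallel to the chord: this is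
  \<open>envelope_tangent_chord\<close>, and regularity of the envelope under the curvature hypothesis is
  immediate from the form of the curvature numerator. The vertices of a Poncelet polygon have
  distinct parameters because an orientation preserving map of finite order with a fixed point is
  the identity (\<open>finite_order_fixed_point_imp_id\<close>).

  The position of the contact points is a convexity statement. If \<open>F\<close> is a lift of \<open>f\<close>, then
  \<open>s = a / (a + F' b)\<close> with \<open>a = \<langle>c, J Y'\<rangle>\<close> and \<open>b = - \<langle>c, J (Y' \<circ> f)\<rangle>\<close>, so that \<open>0 < s < 1\<close> as soon as
  \<open>F' > 0\<close> and each end of the chord lies strictly to the left of the tangent at the other end.
  The latter is \<open>strictly_left_of_tangent\<close>: a simple closed curve whose curvature is positive
  has total turning \<open>2 \<pi>\<close>, so that the distance from a tangent line increases over the first half turn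
  and decreases over the second one. The total turning comes from Hopf's argument
  (\<open>tangent_angle\<close>): simplicity makes the direction of the secants a continuous function without
  zeros on a convex set of pairs of parameters, where it has a continuous logarithm; and the
  secants through a lowest point of the curve stay in a half-plane.\<close>

section \<open>Functions on the line that agree modulo a full turn\<close>

lemma to_circle_shift [simp]: "to_circle (x + 2 * pi * of_int m) = to_circle x"
  using to_circle_eq_iff[of x "x + 2 * pi * of_int m"] by auto

lemma to_circle_shift_turn [simp]: "to_circle (x + 2 * pi) = to_circle x"
  using to_circle_shift[of x 1] by simp

lemma circle_cases: obtains t where "p = to_circle t"
  using to_circle_rep[of p] by metis

lemma lifts_differ_by_constant:
  fixes A B :: "real \<Rightarrow> real"
  assumes "continuous_on UNIV A" "continuous_on UNIV B"
    and eq: "\<And>t. to_circle (A t) = to_circle (B t)"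
  obtains m :: int where "\<And>t. B t = A t + 2 * pi * of_int m"
proof -
  have ex: "\<exists>m::int. B t - A t = 2 * pi * of_int m" for t
    using eq[of t] by (auto simp: to_circle_eq_iff algebra_simps)
  have "(\<lambda>t. B t - A t) constant_on UNIV"
  proof (rule continuous_discrete_range_constant[OF connected_UNIV])
    show "continuous_on UNIV (\<lambda>t. B t - A t)" by (intro continuous_intros assms)
    fix x
    show "\<exists>e>0. \<forall>y. y \<in> UNIV \<and> B y - A y \<noteq> B x - A x \<longrightarrow> e \<le> norm (B y - A y - (B x - A x))"
    proof (intro exI[of _ "2 * pi"] conjI allI impI)
      fix y assume y: "y \<in> UNIV \<and> B y - A y \<noteq> B x - A x"
      obtain i j :: int where ij: "B x - A x = 2 * pi * of_int i" "B y - A y = 2 * pi * of_int j"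
        using ex by metis
      with y have "j \<noteq> i" by auto
      then have "(1::real) \<le> \<bar>of_int (j - i)\<bar>"
        by (metis of_int_1_le_iff of_int_abs zero_less_abs_iff int_one_le_iff_zero_less right_minus_eq)
      then show "2 * pi \<le> norm (B y - A y - (B x - A x))"
        by (simp add: ij flip: right_diff_distrib of_int_diff) (simp add: abs_mult)
    qed simp
  qed
  then obtain c where c: "\<And>t. B t - A t = c" by (auto simp: constant_on_def)
  moreover obtain m :: int where "B 0 - A 0 = 2 * pi * of_int m" using ex by metis
  ultimately show ?thesis using that[of m] by (metis add.commute diff_add_cancel)
qed

section \<open>The total turning of a simple closed curve with positive curvature\<close>

locale simple_closed_curve =
  fixes y y' :: "real \<Rightarrow> complex"
  assumes deriv: "\<And>t. (y has_vector_derivative y' t) (at t)"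
    and cont': "continuous_on UNIV y'"
    and periodic: "\<And>t. y (t + 2 * pi) = y t"
    and regular: "\<And>t. y' t \<noteq> 0"
    and simple: "\<And>s t. s < t \<Longrightarrow> t < s + 2 * pi \<Longrightarrow> y s \<noteq> y t"
begin

lemma periodic': "y' (t + 2 * pi) = y' t"
proof -
  have "((y \<circ> (\<lambda>u. u + 2 * pi)) has_vector_derivative (1 *\<^sub>R y' (t + 2 * pi))) (at t)"
    by (intro vector_diff_chain_at deriv) (auto intro!: derivative_eq_intros)
  then have "(y has_vector_derivative y' (t + 2 * pi)) (at t)"
    by (simp add: o_def periodic)
  with deriv show ?thesis using vector_derivative_unique_at by blast
qed

text \<open>The mean of \<open>y'\<close> between \<open>s\<close> and \<open>t\<close> continues the difference quotient of \<open>y\<close>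
  continuously across the diagonal.\<close>

definition slope :: "real \<Rightarrow> real \<Rightarrow> complex" where
  "slope s t = integral {0..1} (\<lambda>u. y' (s + u * (t - s)))"

lemma slope_diag: "slope s s = y' s"
  by (simp add: slope_def)

lemma slope_mult: "of_real (t - s) * slope s t = y t - y s"
proof -
  have "((\<lambda>u. (t - s) *\<^sub>R y' (s + u * (t - s))) has_integral
          (y (s + 1 * (t - s)) - y (s + 0 * (t - s)))) {0..1}"
  proof (rule fundamental_theorem_of_calculus)
    fix u :: real
    have "((y \<circ> (\<lambda>u. s + u * (t - s))) has_vector_derivative
            ((t - s) *\<^sub>R y' (s + u * (t - s)))) (at u)"
      by (intro vector_diff_chain_at deriv) (auto intro!: derivative_eq_intros)
    then show "((\<lambda>u. y (s + u * (t - s))) has_vector_derivative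
            ((t - s) *\<^sub>R y' (s + u * (t - s)))) (at u within {0..1})"
      by (simp add: o_def has_vector_derivative_at_within)
  qed simp
  from integral_unique[OF this] show ?thesis
    by (simp add: slope_def scaleR_conv_of_real)
qed

lemma continuous_slope: "continuous_on UNIV (\<lambda>(s, t). slope s t)"
proof -
  have "continuous_on (UNIV \<times> cbox (0::real) 1)
          (\<lambda>(p, u). y' (fst p + u * (snd p - fst p)))"
    unfolding case_prod_unfold
    by (intro continuous_on_compose2[OF cont'] continuous_intros) auto
  from integral_continuous_on_param[OF this] show ?thesis
    by (simp add: slope_def case_prod_unfold)
qed

text \<open>Dividing the secant \<open>y t - y s\<close> by \<open>(t - s) (2 \<pi> - (t - s))\<close> removes its zeros on both
  boundary lines of the strip \<open>0 \<le> t - s \<le> 2 \<pi>\<close>: near \<open>t = s + 2 \<pi>\<close> the secant is also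
  the one from \<open>s\<close> to \<open>t - 2 \<pi>\<close>. The strip is convex, so that the quotient has a continuous
  logarithm. The boundary values show that its imaginary part is a tangent angle on the diagonal,
  and that the tangent is reversed on the other boundary line.\<close>

lemma secant_logarithm:
  obtains W :: "real \<times> real \<Rightarrow> complex" where
    "continuous_on {(s, t). s \<le> t \<and> t \<le> s + 2 * pi} W"
    "\<And>s t. s < t \<Longrightarrow> t < s + 2 * pi \<Longrightarrow>
       y t - y s = of_real ((t - s) * (2 * pi - (t - s))) * exp (W (s, t))"
    "\<And>s. y' s = of_real (2 * pi) * exp (W (s, s))"
    "\<And>s. y' s = - of_real (2 * pi) * exp (W (s, s + 2 * pi))"
proof -
  define Z where "Z = (\<lambda>(s, t). if t - s \<le> pi then slope s t / of_real (2 * pi - (t - s))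
                               else - slope s (t - 2 * pi) / of_real (t - s))"
  let ?S = "{(s::real, t). s \<le> t \<and> t \<le> s + 2 * pi}"
  let ?L = "{(s::real, t). s \<le> t \<and> t \<le> s + pi}" and ?R = "{(s::real, t). s + pi \<le> t \<and> t \<le> s + 2 * pi}"
  have cslope: "continuous_on A (\<lambda>p. slope (g p) (h p))"
    if "continuous_on A g" "continuous_on A h" for A :: "(real \<times> real) set" and g h
    using continuous_on_compose2[OF continuous_slope continuous_on_Pair[OF that]] by simp
  have agree: "slope s t / of_real (2 * pi - (t - s)) = - slope s (t - 2 * pi) / of_real (t - s)"
    if "0 < t - s" "t - s < 2 * pi" for s t
  proof -
    have "of_real (t - s) * slope s t = of_real (t - 2 * pi - s) * slope s (t - 2 * pi)"
      using slope_mult[of t s] slope_mult[of "t - 2 * pi" s] periodic[of "t - 2 * pi"] by simp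
    moreover have "of_real (t - s) \<noteq> (0::complex)" "of_real (2 * pi - (t - s)) \<noteq> (0::complex)"
      using that by (simp_all only: of_real_eq_0_iff)
    moreover have "of_real (t - 2 * pi - s) = - (of_real (2 * pi - (t - s)) :: complex)"
      by (simp add: algebra_simps)
    ultimately show ?thesis by (metis frac_eq_eq minus_mult_commute mult.commute)
  qed
  have split: "?S = ?L \<union> ?R" using pi_gt_zero by auto
  have closed: "closed ?L" "closed ?R"
    unfolding case_prod_unfold by (intro closed_Collect_conj closed_Collect_le continuous_intros)+
  have ne: "p \<in> ?L \<Longrightarrow> of_real (2 * pi - (snd p - fst p)) \<noteq> (0::complex)"
    "p \<in> ?R \<Longrightarrow> of_real (snd p - fst p) \<noteq> (0::complex)" for p
  proof -
    assume "p \<in> ?L"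
    then have "snd p - fst p \<le> pi" by auto
    then have "2 * pi - (snd p - fst p) \<noteq> 0" using pi_gt_zero by linarith
    then show "of_real (2 * pi - (snd p - fst p)) \<noteq> (0::complex)"
      by (metis of_real_eq_0_iff)
  next
    assume "p \<in> ?R"
    then have "pi \<le> snd p - fst p" by auto
    then have "snd p - fst p \<noteq> 0" using pi_gt_zero by linarith
    then show "of_real (snd p - fst p) \<noteq> (0::complex)"
      by (metis of_real_eq_0_iff)
  qed
  have "continuous_on (?L \<union> ?R) (\<lambda>p. if snd p - fst p \<le> pi
           then slope (fst p) (snd p) / of_real (2 * pi - (snd p - fst p))
           else - slope (fst p) (snd p - 2 * pi) / of_real (snd p - fst p))"
  proof (rule continuous_on_cases[OF closed])
    show "continuous_on ?L (\<lambda>p. slope (fst p) (snd p) / of_real (2 * pi - (snd p - fst p)))"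
      by (intro continuous_intros cslope ballI ne)
    show "continuous_on ?R (\<lambda>p. - slope (fst p) (snd p - 2 * pi) / of_real (snd p - fst p))"
      by (intro continuous_intros cslope ballI ne)
    show "\<forall>p. p \<in> ?L \<and> \<not> snd p - fst p \<le> pi \<or> p \<in> ?R \<and> snd p - fst p \<le> pi \<longrightarrow>
        slope (fst p) (snd p) / of_real (2 * pi - (snd p - fst p)) =
        - slope (fst p) (snd p - 2 * pi) / of_real (snd p - fst p)"
    proof (intro allI impI)
      fix p assume "p \<in> ?L \<and> \<not> snd p - fst p \<le> pi \<or> p \<in> ?R \<and> snd p - fst p \<le> pi"
      then have "snd p - fst p = pi" by auto
      then show "slope (fst p) (snd p) / of_real (2 * pi - (snd p - fst p)) =
        - slope (fst p) (snd p - 2 * pi) / of_real (snd p - fst p)"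
        using agree[of "snd p" "fst p"] pi_gt_zero by simp
    qed
  qed
  then have contZ: "continuous_on ?S Z"
    by (subst split) (simp only: Z_def case_prod_unfold)
  have secant: "y t - y s = of_real ((t - s) * (2 * pi - (t - s))) * Z (s, t)"
    if "s < t" "t < s + 2 * pi" for s t
  proof -
    have "Z (s, t) = slope s t / of_real (2 * pi - (t - s))"
      using agree[of t s] that by (auto simp: Z_def)
    moreover have "of_real (2 * pi - (t - s)) \<noteq> (0::complex)"
      using that by (simp only: of_real_eq_0_iff)
    ultimately show ?thesis using slope_mult[of t s] by (simp only: of_real_mult) simp
  qed
  have diag: "y' s = of_real (2 * pi) * Z (s, s)" for s
    by (simp add: Z_def slope_diag)
  have turn: "y' s = - of_real (2 * pi) * Z (s, s + 2 * pi)" for s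
    by (simp add: Z_def slope_diag)
  have nz: "Z z \<noteq> 0" if inS: "z \<in> ?S" for z
  proof -
    obtain s t where z: "z = (s, t)" "s \<le> t" "t \<le> s + 2 * pi"
      using inS by (cases z) auto
    then consider "t = s" | "t = s + 2 * pi" | "s < t" "t < s + 2 * pi" by linarith
    then show ?thesis
    proof cases
      case 1 then show ?thesis using diag[of s] regular[of s] z by auto
    next
      case 2 then show ?thesis using turn[of s] regular[of s] z by auto
    next
      case 3 then show ?thesis using secant[OF 3] simple[OF 3] z by auto
    qed
  qed
  have "convex ?S"
  proof (rule convexI)
    fix p q and u v :: real
    assume pq: "p \<in> ?S" "q \<in> ?S" and uv: "0 \<le> u" "0 \<le> v" "u + v = 1"
    obtain a b c d where e: "p = (a, b)" "q = (c, d)" by (metis surj_pair)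
    have "u * a + v * c \<le> u * b + v * d"
      using pq uv e by (intro add_mono mult_left_mono) auto
    moreover have "u * b + v * d \<le> u * (a + 2 * pi) + v * (c + 2 * pi)"
      using pq uv e by (intro add_mono mult_left_mono) auto
    moreover have "u * (a + 2 * pi) + v * (c + 2 * pi) = u * a + v * c + (u + v) * (2 * pi)"
      by (simp add: algebra_simps)
    ultimately show "u *\<^sub>R p + v *\<^sub>R q \<in> ?S" using uv e by simp
  qed
  then have "contractible ?S" by (rule convex_imp_contractible)
  with contZ obtain W where W: "continuous_on ?S W" "\<And>z. z \<in> ?S \<Longrightarrow> Z z = exp (W z)"
    by (rule continuous_logarithm_on_contractible) (rule nz, assumption, rule that, blast+)
  show ?thesis
  proof (rule that[of W])
    show "y t - y s = of_real ((t - s) * (2 * pi - (t - s))) * exp (W (s, t))"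
      if "s < t" "t < s + 2 * pi" for s t
      using secant[OF that] W(2)[of "(s, t)"] that by simp
    show "y' s = of_real (2 * pi) * exp (W (s, s))" for s
      using diag[of s] W(2)[of "(s, s)"] by simp
    show "y' s = - of_real (2 * pi) * exp (W (s, s + 2 * pi))" for s
      using turn[of s] W(2)[of "(s, s + 2 * pi)"] by simp
  qed (rule W)
qed

end

text \<open>An interval of length \<open>2 \<pi>\<close> contains an angle at which the sine is \<open>-1\<close>.\<close>

lemma angle_variation_sin_nonneg:
  fixes \<phi> :: "real \<Rightarrow> real"
  assumes "a \<le> b" "continuous_on {a..b} \<phi>" "\<And>t. a \<le> t \<Longrightarrow> t \<le> b \<Longrightarrow> 0 \<le> sin (\<phi> t)"
  shows "\<phi> b - \<phi> a < 2 * pi"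
proof (rule ccontr)
  assume big: "\<not> \<phi> b - \<phi> a < 2 * pi"
  define m where "m = \<lceil>(\<phi> a + pi / 2) / (2 * pi)\<rceil>"
  define v where "v = - (pi / 2) + 2 * pi * of_int m"
  have "(\<phi> a + pi / 2) / (2 * pi) \<le> of_int m" "of_int m < (\<phi> a + pi / 2) / (2 * pi) + 1"
    unfolding m_def by linarith+
  then have "\<phi> a \<le> v" "v \<le> \<phi> a + 2 * pi"
    unfolding v_def by (auto simp: field_simps)
  then obtain t where t: "a \<le> t" "t \<le> b" "\<phi> t = v"
    using IVT'[of \<phi> a v b] big assms by auto
  have "sin v = -1"
    unfolding v_def by (simp only: sin_add sin_int_2pin cos_int_2pin) simp
  with assms(3)[OF t(1,2)] t show False by simp
qed

locale positively_curved_simple_closed_curve = simple_closed_curve +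
  fixes y'' :: "real \<Rightarrow> complex"
  assumes deriv': "\<And>t. (y' has_vector_derivative y'' t) (at t)"
    and curvature_pos: "\<And>t. 0 < Im (y'' t * cnj (y' t))"
begin

text \<open>Near a given parameter the continuous angle differs by a constant from the principal
  argument of a quotient of tangents, and is therefore differentiable; its derivative is the
  curvature, up to the speed.\<close>

lemma tangent_angle_strict_mono:
  assumes cont: "continuous_on UNIV w" and exp: "\<And>t. y' t = of_real (2 * pi) * exp (w t)"
  shows "strict_mono (\<lambda>t. Im (w t))"
proof -
  have "\<exists>d>0. ((\<lambda>t. Im (w t)) has_real_derivative d) (at t)" for t
  proof -
    have "continuous (at t) w" using cont by (simp add: continuous_on_eq_continuous_at)
    then obtain \<delta> where \<delta>: "0 < \<delta>" "\<And>u. dist u t < \<delta> \<Longrightarrow> dist (w u) (w t) < pi"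
      unfolding continuous_at_eps_delta using pi_gt_zero by metis
    have eq: "Ln (y' u / y' t) + w t = w u" if "dist u t < \<delta>" for u
    proof -
      have "\<bar>Im (w u - w t)\<bar> < pi"
        using \<delta>(2)[OF that] abs_Im_le_cmod[of "w u - w t"] by (simp add: dist_norm)
      moreover have "y' u / y' t = exp (w u - w t)" by (simp add: exp[of u] exp[of t] exp_diff)
      ultimately show ?thesis by (auto simp: Ln_exp)
    qed
    have "((\<lambda>u. y' u / y' t) has_vector_derivative (y'' t / y' t)) (at t)"
      by (intro has_vector_derivative_divide deriv')
    moreover have "(Ln has_field_derivative 1) (at (y' t / y' t))"
      using regular[of t] has_field_derivative_Ln[of 1] by simp
    ultimately have "((Ln \<circ> (\<lambda>u. y' u / y' t)) has_vector_derivative (y'' t / y' t * 1)) (at t)"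
      by (rule field_vector_diff_chain_at)
    then have "((\<lambda>u. Ln (y' u / y' t) + w t) has_vector_derivative (y'' t / y' t + 0)) (at t)"
      by (intro has_vector_derivative_add) (auto simp: o_def)
    then have "((\<lambda>u. w u) has_vector_derivative (y'' t / y' t + 0)) (at t)"
      by (rule has_vector_derivative_transform_within[OF _ \<delta>(1)]) (auto intro: eq)
    then have "(w has_vector_derivative (y'' t / y' t)) (at t)" by simp
    then have "((\<lambda>t. Im (w t)) has_real_derivative Im (y'' t / y' t)) (at t)"
      using bounded_linear.has_vector_derivative[OF bounded_linear_Im]
      by (simp add: has_real_derivative_iff_has_vector_derivative)
    moreover have "Im (y'' t / y' t) > 0"
      using curvature_pos[of t] regular[of t]
      by (subst complex_div_cnj) (simp add: Im_divide_of_real)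
    ultimately show ?thesis by blast
  qed
  then show ?thesis
    by (intro strict_monoI DERIV_pos_imp_increasing[where f = "\<lambda>t. Im (w t)"]) auto
qed

text \<open>Hopf's rotation index theorem. Going from \<open>(t0, t0)\<close> to \<open>(t0 + 2 \<pi>, t0 + 2 \<pi>)\<close> along
  the sides of the triangle instead of the diagonal, the secants issue from the lowest point
  \<open>y t0\<close> on the first side and end there on the second: on each of them they
  stay in a half-plane and turn by less than \<open>2 \<pi>\<close>. Hence the total turning, a positive multiple of
  \<open>2 \<pi>\<close>, is less than \<open>4 \<pi>\<close>.\<close>

lemma tangent_angle:
  obtains r \<theta> :: "real \<Rightarrow> real" where
    "\<And>t. 0 < r t" "\<And>t. y' t = of_real (r t) * cis (\<theta> t)"
    "continuous_on UNIV \<theta>" "strict_mono \<theta>" "\<And>t. \<theta> (t + 2 * pi) = \<theta> t + 2 * pi"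
proof -
  let ?S = "{(s::real, t). s \<le> t \<and> t \<le> s + 2 * pi}"
  obtain W where contW: "continuous_on ?S W"
    and secant: "\<And>s t. s < t \<Longrightarrow> t < s + 2 * pi \<Longrightarrow>
       y t - y s = of_real ((t - s) * (2 * pi - (t - s))) * exp (W (s, t))"
    and diag: "\<And>s. y' s = of_real (2 * pi) * exp (W (s, s))"
    and turn: "\<And>s. y' s = - of_real (2 * pi) * exp (W (s, s + 2 * pi))"
    by (rule secant_logarithm) (rule that, blast+)
  define \<theta> where "\<theta> = (\<lambda>t. Im (W (t, t)))"
  have contd: "continuous_on UNIV (\<lambda>t. W (t, t))"
    by (rule continuous_on_compose2[OF contW]) (auto intro!: continuous_intros)
  then have cont\<theta>: "continuous_on UNIV \<theta>" unfolding \<theta>_def by (intro continuous_intros)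
  have mono: "strict_mono \<theta>"
    unfolding \<theta>_def by (rule tangent_angle_strict_mono[OF contd diag])
  have polar: "y' t = of_real (2 * pi * exp (Re (W (t, t)))) * cis (\<theta> t)" for t
    unfolding diag[of t] \<theta>_def exp_eq_polar[of "W (t, t)"] by (simp add: exp_of_real)
  have same: "to_circle (\<theta> t) = to_circle (\<theta> (t + 2 * pi))" for t
  proof -
    have "exp (W (t, t)) = exp (W (t + 2 * pi, t + 2 * pi))"
      using diag[of t] diag[of "t + 2 * pi"] periodic'[of t] by simp
    then obtain j :: int where
        "W (t, t) = W (t + 2 * pi, t + 2 * pi) + (of_int (2 * j) * pi) * \<i>"
      unfolding exp_eq by blast
    then have "\<theta> t = \<theta> (t + 2 * pi) + 2 * pi * of_int j" by (simp add: \<theta>_def)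
    then show ?thesis by simp
  qed
  have "continuous_on UNIV (\<lambda>t. \<theta> (t + 2 * pi))"
    by (rule continuous_on_compose2[OF cont\<theta>]) (auto intro!: continuous_intros)
  then obtain m :: int where m: "\<And>t. \<theta> (t + 2 * pi) = \<theta> t + 2 * pi * of_int m"
    by (rule lifts_differ_by_constant[OF cont\<theta> _ same]) (rule that, blast)
  have "continuous_on {0..2 * pi} y"
    by (meson continuous_at_imp_continuous_on deriv has_vector_derivative_continuous)
  then have "continuous_on {0..2 * pi} (\<lambda>t. Im (y t))" by (rule continuous_on_Im)
  then obtain t0 where t0: "\<And>t. t \<in> {0..2 * pi} \<Longrightarrow> Im (y t0) \<le> Im (y t)"
    using continuous_attains_inf[OF compact_Icc, of 0 "2 * pi" "\<lambda>t. Im (y t)"] pi_ge_zero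
    by (metis atLeastatMost_empty_iff mult_nonneg_nonneg zero_le_numeral)
  have periodicm: "y (t + 2 * pi * of_int i) = y t" for t and i :: int
  proof -
    have nat: "y (t + 2 * pi * of_nat j) = y t" for t and j :: nat
    proof (induction j)
      case (Suc j)
      then show ?case using periodic[of "t + 2 * pi * of_nat j"] by (simp add: algebra_simps)
    qed simp
    show ?thesis
    proof (cases "0 \<le> i")
      case True then show ?thesis using nat[of t "nat i"] by simp
    next
      case False
      then show ?thesis using nat[of "t + 2 * pi * of_int i" "nat (- i)"] by simp
    qed
  qed
  have low: "Im (y t0) \<le> Im (y t)" for t
  proof -
    define i where "i = \<lfloor>t / (2 * pi)\<rfloor>"
    have "of_int i \<le> t / (2 * pi)" "t / (2 * pi) < of_int i + 1" unfolding i_def by linarith+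
    then have "t + 2 * pi * of_int (- i) \<in> {0..2 * pi}" by (auto simp: field_simps)
    from t0[OF this] show ?thesis by (simp only: periodicm)
  qed
  have "((\<lambda>t. Im (y t)) has_real_derivative Im (y' t0)) (at t0)"
    using bounded_linear.has_vector_derivative[OF bounded_linear_Im deriv]
    by (simp add: has_real_derivative_iff_has_vector_derivative)
  then have flat: "Im (y' t0) = 0" by (rule DERIV_local_min[of _ _ _ 1]) (auto simp: low)
  have flat': "Im (y' (t0 + 2 * pi)) = 0" using flat periodic' by simp
  have sin_iff: "Im (of_real c * exp z) = c * exp (Re z) * sin (Im z)" for c z
    by (simp add: Im_exp)
  have side1: "Im (W (t0, t0 + 2 * pi)) - Im (W (t0, t0)) < 2 * pi"
  proof (rule angle_variation_sin_nonneg[of t0 "t0 + 2 * pi" "\<lambda>t. Im (W (t0, t))"])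
    show "continuous_on {t0..t0 + 2 * pi} (\<lambda>t. Im (W (t0, t)))"
      by (intro continuous_intros continuous_on_compose2[OF contW]) auto
    fix t assume "t0 \<le> t" "t \<le> t0 + 2 * pi"
    then consider "t = t0" | "t = t0 + 2 * pi" | "t0 < t" "t < t0 + 2 * pi" by linarith
    then show "0 \<le> sin (Im (W (t0, t)))"
    proof cases
      case 1 then show ?thesis using flat diag[of t0] sin_iff[of "2 * pi"] by simp
    next
      case 2 then show ?thesis using flat turn[of t0] sin_iff[of "- (2 * pi)"] by simp
    next
      case 3
      define c where "c = (t - t0) * (2 * pi - (t - t0))"
      have "0 < c" using 3 by (auto simp: c_def)
      then have "0 < c * exp (Re (W (t0, t)))" by simp
      moreover have "0 \<le> c * exp (Re (W (t0, t))) * sin (Im (W (t0, t)))"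
        using secant[OF 3] low[of t] sin_iff[of c "W (t0, t)"]
        by (metis c_def diff_ge_0_iff_ge minus_complex.sel(2))
      ultimately show ?thesis by (metis mult_pos_neg not_le)
    qed
  qed simp
  have side2: "(Im (W (t0 + 2 * pi, t0 + 2 * pi)) + pi) - (Im (W (t0, t0 + 2 * pi)) + pi) < 2 * pi"
  proof (rule angle_variation_sin_nonneg[of t0 "t0 + 2 * pi" "\<lambda>t. Im (W (t, t0 + 2 * pi)) + pi"])
    show "continuous_on {t0..t0 + 2 * pi} (\<lambda>t. Im (W (t, t0 + 2 * pi)) + pi)"
      by (intro continuous_intros continuous_on_compose2[OF contW]) auto
    fix t assume "t0 \<le> t" "t \<le> t0 + 2 * pi"
    then consider "t = t0" | "t = t0 + 2 * pi" | "t < t0 + 2 * pi" "t0 + 2 * pi < t + 2 * pi"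
      by linarith
    then have "sin (Im (W (t, t0 + 2 * pi))) \<le> 0"
    proof cases
      case 1 then show ?thesis using flat turn[of t0] sin_iff[of "- (2 * pi)"] by simp
    next
      case 2 then show ?thesis using flat' diag[of "t0 + 2 * pi"] sin_iff[of "2 * pi"] by simp
    next
      case 3
      define c where "c = (t0 + 2 * pi - t) * (2 * pi - (t0 + 2 * pi - t))"
      have "0 < c" using 3 by (auto simp: c_def)
      then have "0 < c * exp (Re (W (t, t0 + 2 * pi)))" by simp
      moreover have "c * exp (Re (W (t, t0 + 2 * pi))) * sin (Im (W (t, t0 + 2 * pi))) \<le> 0"
        using secant[OF 3] low[of t] sin_iff[of c "W (t, t0 + 2 * pi)"] periodic[of t0]
        by (metis c_def diff_le_0_iff_le minus_complex.sel(2))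
      ultimately show ?thesis by (metis mult_pos_pos not_le)
    qed
    then show "0 \<le> sin (Im (W (t, t0 + 2 * pi)) + pi)" by simp
  qed simp
  have "2 * pi * of_int m < 2 * pi * 2"
    using side1 side2 m[of t0] unfolding \<theta>_def by linarith
  then have "real_of_int m < 2" by (rule mult_left_less_imp_less) simp
  moreover have "2 * pi * 0 < 2 * pi * of_int m"
    using strict_monoD[OF mono, of t0 "t0 + 2 * pi"] m[of t0] pi_gt_zero by simp
  then have "0 < real_of_int m" by (rule mult_left_less_imp_less) simp
  ultimately have "m = 1" by linarith
  show ?thesis
    by (rule that[OF _ polar cont\<theta> mono]) (simp_all add: m \<open>m = 1\<close>)
qed

text \<open>The distance of \<open>y u\<close> from the tangent line at \<open>y s\<close> vanishes for \<open>u = s\<close> and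
  \<open>u = s + 2 \<pi>\<close>. It increases until the tangent has turned by \<open>\<pi>\<close> and decreases from
  then on.\<close>

lemma left_of_tangent:
  assumes "s < t" "t < s + 2 * pi"
  shows "0 < Im ((y t - y s) * cnj (y' s))"
proof -
  obtain r \<theta> :: "real \<Rightarrow> real" where r: "\<And>t. 0 < r t"
    and polar: "\<And>t. y' t = of_real (r t) * cis (\<theta> t)"
    and cont: "continuous_on UNIV \<theta>" and mono: "strict_mono \<theta>"
    and turn: "\<And>t. \<theta> (t + 2 * pi) = \<theta> t + 2 * pi"
    by (rule tangent_angle) (rule that, blast+)
  define h where "h = (\<lambda>u. Im ((y u - y s) * cnj (y' s)))"
  have dh: "(h has_real_derivative r u * r s * sin (\<theta> u - \<theta> s)) (at u)" for u
  proof -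
    have "((\<lambda>u. (y u - y s) * cnj (y' s)) has_vector_derivative (y' u * cnj (y' s))) (at u)"
      by (auto intro!: derivative_eq_intros deriv)
    from bounded_linear.has_vector_derivative[OF bounded_linear_Im this]
    have "(h has_real_derivative Im (y' u * cnj (y' s))) (at u)"
      by (simp add: h_def has_real_derivative_iff_has_vector_derivative)
    moreover have "Im (y' u * cnj (y' s)) = r u * r s * sin (\<theta> u - \<theta> s)"
      by (simp add: polar[of u] polar[of s] sin_diff algebra_simps)
    ultimately show ?thesis by simp
  qed
  have conth: "continuous_on A h" for A
    by (meson DERIV_continuous_on dh has_field_derivative_at_within)
  obtain u0 where u0: "s \<le> u0" "u0 \<le> s + 2 * pi" "\<theta> u0 = \<theta> s + pi"
    using IVT'[of \<theta> s "\<theta> s + pi" "s + 2 * pi"] turn[of s] continuous_on_subset[OF cont] pi_gt_zero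
    by auto
  show ?thesis
  proof (cases "t \<le> u0")
    case True
    have "h s < h t"
    proof (rule DERIV_pos_imp_increasing_open[OF assms(1) _ conth])
      fix u assume "s < u" "u < t"
      with True u0 have "\<theta> s < \<theta> u" "\<theta> u < \<theta> s + pi"
        using strict_mono_less[OF mono, of s u] strict_mono_less[OF mono, of u u0] by auto
      then have "0 < sin (\<theta> u - \<theta> s)" by (intro sin_gt_zero) auto
      then show "\<exists>d. (h has_real_derivative d) (at u) \<and> 0 < d"
        using dh[of u] r[of u] r[of s] by (meson mult_pos_pos)
    qed
    then show ?thesis by (simp add: h_def)
  next
    case False
    have "h t > h (s + 2 * pi)"
    proof (rule DERIV_neg_imp_decreasing_open[OF assms(2) _ conth])
      fix u assume "t < u" "u < s + 2 * pi"
      with False u0 have "\<theta> s + pi < \<theta> u" "\<theta> u < \<theta> s + 2 * pi"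
        using strict_mono_less[OF mono, of u0 u] strict_mono_less[OF mono, of u "s + 2 * pi"] turn[of s]
        by auto
      then have "sin (\<theta> u - \<theta> s) < 0" by (intro sin_lt_zero) auto
      then show "\<exists>d. (h has_real_derivative d) (at u) \<and> d < 0"
        using dh[of u] r[of u] r[of s] by (meson mult_pos_pos mult_pos_neg)
    qed
    then show ?thesis by (simp add: h_def periodic)
  qed
qed

end

section \<open>Calculus of \<open>k\<close> times continuously differentiable functions\<close>

lemma Ck_SucI:
  assumes "\<And>t. (g has_vector_derivative g' t) (at t)" "Ck k g'"
  shows "Ck (Suc k) g"
proof -
  have "(\<lambda>t. vector_derivative g (at t)) = g'"
    using assms(1) by (auto intro: vector_derivative_at)
  with assms(2) differentiableI_vector[OF assms(1)] show ?thesis by auto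
qed

lemma Ck_SucE:
  assumes "Ck (Suc k) g"
  obtains g' where "\<And>t. (g has_vector_derivative g' t) (at t)" "Ck k g'"
  using assms that[of "\<lambda>t. vector_derivative g (at t)"] by (auto simp: vector_derivative_works)

lemma Ck_has_real_derivative:
  "Ck (Suc k) g \<Longrightarrow> (g has_real_derivative vector_derivative g (at t)) (at t)"
  by (simp add: has_real_derivative_iff_has_vector_derivative vector_derivative_works)

lemma Ck_imp_continuous: "Ck k g \<Longrightarrow> continuous_on A g"
proof (cases k)
  case (Suc j)
  moreover assume "Ck k g"
  ultimately have "\<forall>t. g differentiable at t" by simp
  then show ?thesis
    by (meson continuous_at_imp_continuous_on differentiable_imp_continuous_within)
qed (auto intro: continuous_on_subset)

lemma Ck_SucD: "Ck (Suc k) g \<Longrightarrow> Ck k g"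
proof (induction k arbitrary: g)
  case 0 then show ?case using Ck_imp_continuous[of 1 g] by simp
next
  case (Suc k)
  then show ?case by (metis Ck.simps(2))
qed

lemma Ck_mono: "Ck k g \<Longrightarrow> j \<le> k \<Longrightarrow> Ck j g"
  by (induction k) (auto simp: le_Suc_eq dest: Ck_SucD simp del: Ck.simps(2))

lemma Ck_add: "Ck k g \<Longrightarrow> Ck k h \<Longrightarrow> Ck k (\<lambda>t. g t + h t)"
proof (induction k arbitrary: g h)
  case 0 then show ?case by (simp add: continuous_on_add)
next
  case (Suc k)
  obtain g' h' where d: "\<And>t. (g has_vector_derivative g' t) (at t)" "Ck k g'"
    "\<And>t. (h has_vector_derivative h' t) (at t)" "Ck k h'"
    using Suc.prems by (auto elim!: Ck_SucE simp del: Ck.simps(2))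
  show ?case
    by (rule Ck_SucI[OF has_vector_derivative_add[OF d(1,3)] Suc.IH[OF d(2,4)]])
qed

lemma Ck_linear: "bounded_linear L \<Longrightarrow> Ck k g \<Longrightarrow> Ck k (\<lambda>t. L (g t))"
proof (induction k arbitrary: g)
  case 0 then show ?case by (simp add: bounded_linear.continuous_on)
next
  case (Suc k)
  from Suc.prems(2) obtain g' where d: "\<And>t. (g has_vector_derivative g' t) (at t)" "Ck k g'"
    by (auto elim!: Ck_SucE simp del: Ck.simps(2))
  show ?case
    by (rule Ck_SucI[OF bounded_linear.has_vector_derivative[OF Suc.prems(1) d(1)]
          Suc.IH[OF Suc.prems(1) d(2)]])
qed

lemma Ck_diff: "Ck k g \<Longrightarrow> Ck k h \<Longrightarrow> Ck k (\<lambda>t. g t - h t)"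
  using Ck_add[OF _ Ck_linear[OF bounded_linear_minus[OF bounded_linear_ident]], of k g h] by simp

lemma Ck_bilinear:
  assumes "bounded_bilinear B"
  shows "Ck k g \<Longrightarrow> Ck k h \<Longrightarrow> Ck k (\<lambda>t. B (g t) (h t))"
proof (induction k arbitrary: g h)
  case 0 then show ?case by (simp add: bounded_bilinear.continuous_on[OF assms])
next
  case (Suc k)
  obtain g' h' where d: "\<And>t. (g has_vector_derivative g' t) (at t)" "Ck k g'"
    "\<And>t. (h has_vector_derivative h' t) (at t)" "Ck k h'"
    using Suc.prems by (auto elim!: Ck_SucE simp del: Ck.simps(2))
  show ?case
  proof (rule Ck_SucI)
    show "((\<lambda>t. B (g t) (h t)) has_vector_derivative (B (g t) (h' t) + B (g' t) (h t))) (at t)" for t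
      by (intro bounded_bilinear.has_vector_derivative[OF assms] d)
    show "Ck k (\<lambda>t. B (g t) (h' t) + B (g' t) (h t))"
      using Suc d by (intro Ck_add Suc.IH) (auto dest: Ck_SucD simp del: Ck.simps(2))
  qed
qed

lemma Ck_compose: "Ck k g \<Longrightarrow> Ck k F \<Longrightarrow> Ck k (\<lambda>t. g (F t))"
proof (induction k arbitrary: g F)
  case 0 then show ?case by (auto intro: continuous_on_compose2)
next
  case (Suc k)
  obtain g' where g': "\<And>t. (g has_vector_derivative g' t) (at t)" "Ck k g'"
    by (rule Ck_SucE[OF Suc.prems(1)]) (rule that, blast+)
  obtain F' where F': "\<And>t. (F has_vector_derivative F' t) (at t)" "Ck k F'"
    by (rule Ck_SucE[OF Suc.prems(2)]) (rule that, blast+)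
  show ?case
  proof (rule Ck_SucI)
    show "((\<lambda>t. g (F t)) has_vector_derivative (F' t *\<^sub>R g' (F t))) (at t)" for t
      using vector_diff_chain_at[OF F'(1) g'(1)] by (simp add: o_def)
    show "Ck k (\<lambda>t. F' t *\<^sub>R g' (F t))"
      by (rule Ck_bilinear[OF bounded_bilinear_scaleR F'(2) Suc.IH[OF g'(2) Ck_SucD[OF Suc.prems(2)]]])
  qed
qed

lemma Ck_inverse:
  fixes g :: "real \<Rightarrow> real"
  assumes nz: "\<And>t. g t \<noteq> 0"
  shows "Ck k g \<Longrightarrow> Ck k (\<lambda>t. inverse (g t))"
proof (induction k)
  case 0 then show ?case by (simp add: continuous_on_inverse nz)
next
  case (Suc k)
  obtain g' where d: "\<And>t. (g has_vector_derivative g' t) (at t)" "Ck k g'"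
    using Suc.prems by (auto elim!: Ck_SucE simp del: Ck.simps(2))
  show ?case
  proof (rule Ck_SucI)
    fix t
    have "((\<lambda>t. inverse (g t)) has_real_derivative - (inverse (g t) * g' t * inverse (g t))) (at t)"
      using d(1)[of t] nz[of t]
      by (intro DERIV_inverse') (simp_all add: has_real_derivative_iff_has_vector_derivative)
    then show "((\<lambda>t. inverse (g t)) has_vector_derivative
        - (inverse (g t) * g' t * inverse (g t))) (at t)"
      by (simp add: has_real_derivative_iff_has_vector_derivative)
  next
    show "Ck k (\<lambda>t. - (inverse (g t) * g' t * inverse (g t)))"
      using Suc.IH[OF Ck_SucD[OF Suc.prems]] d(2)
      by (intro Ck_linear[OF bounded_linear_minus[OF bounded_linear_ident]]
          Ck_bilinear[OF bounded_bilinear_mult])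
  qed
qed

lemma Ck_curve_circle_deriv: "Ck_curve (Suc k) Y \<Longrightarrow> Ck_curve k (circle_deriv Y)"
  by (simp add: Ck_curve_def circle_deriv_to_circle)

lemma Ck_curve_has_vector_derivative:
  assumes "Ck_curve (Suc k) Y"
  shows "((\<lambda>t. Y (to_circle t)) has_vector_derivative circle_deriv Y (to_circle t)) (at t)"
  using assms by (simp add: Ck_curve_def circle_deriv_to_circle vector_derivative_works)

lemma circle_deriv_eqI:
  "((\<lambda>t. Y (to_circle t)) has_vector_derivative d) (at t) \<Longrightarrow> circle_deriv Y (to_circle t) = d"
  by (simp add: circle_deriv_to_circle vector_derivative_at)

section \<open>Torsion maps of the circle\<close>

lemma lift_funpow:
  assumes "\<And>t. f (to_circle t) = to_circle (F t)"
  shows "(f ^^ i) (to_circle t) = to_circle ((F ^^ i) t)"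
  by (induction i) (simp_all add: assms)

lemma strict_mono_funpow:
  fixes F :: "'a::order \<Rightarrow> 'a"
  assumes "strict_mono F"
  shows "strict_mono (F ^^ i)"
  using assms by (induction i) (auto simp: strict_mono_def)

lemma continuous_on_funpow:
  fixes F :: "'a::topological_space \<Rightarrow> 'a"
  assumes "continuous_on UNIV F"
  shows "continuous_on UNIV (F ^^ i)"
  by (induction i) (auto simp: o_def id_def intro: continuous_on_compose2[OF assms])

lemma orientation_preserving_funpow:
  "orientation_preserving f \<Longrightarrow> orientation_preserving (f ^^ i)"
  unfolding orientation_preserving_def
  by (meson continuous_on_funpow lift_funpow strict_mono_funpow)

lemma strict_mono_periodic_point:
  fixes H :: "'a::linorder \<Rightarrow> 'a"
  assumes H: "strict_mono H" and per: "(H ^^ n) t = t" and "0 < n"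
  shows "H t = t"
proof -
  obtain j where n: "n = Suc j" using \<open>0 < n\<close> by (cases n) auto
  have "t < (H ^^ Suc j) t" if up: "t < H t"
  proof (induction j)
    case (Suc j)
    from strict_monoD[OF H Suc] up show ?case by simp
  qed (simp add: up)
  moreover have "(H ^^ Suc j) t < t" if down: "H t < t"
  proof (induction j)
    case (Suc j)
    from strict_monoD[OF H Suc] down show ?case by simp
  qed (simp add: down)
  ultimately show ?thesis using per n by (metis linorder_neqE less_irrefl)
qed

text \<open>Among the lifts of the map there is one with a fixed point. Its \<open>n\<close>-th iterate lifts the
  identity and has a fixed point, so that it is the identity; and an increasing map of the line has
  no periodic points besides its fixed points.\<close>

lemma finite_order_fixed_point_imp_id:
  assumes "orientation_preserving g" and order: "g ^^ n = id" "0 < n" and fixed: "g p = p"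
  shows "g = id"
proof -
  obtain G where G: "continuous_on UNIV G" "strict_mono G" "\<And>t. g (to_circle t) = to_circle (G t)"
    using assms(1) unfolding orientation_preserving_def by blast
  obtain t0 where p: "p = to_circle t0" by (rule circle_cases)
  obtain m :: int where m: "G t0 = t0 + 2 * pi * of_int m"
    using fixed p G(3)[of t0] to_circle_eq_iff[of t0 "G t0"] by auto
  define H where "H = (\<lambda>t. G t + 2 * pi * of_int (- m))"
  have contH: "continuous_on UNIV H" unfolding H_def by (intro continuous_intros G)
  have monoH: "strict_mono H" using G(2) by (simp add: H_def strict_mono_def)
  have liftH: "g (to_circle t) = to_circle (H t)" for t
    unfolding H_def to_circle_shift by (rule G)
  have H0: "H t0 = t0" by (simp add: H_def m)
  have "to_circle ((H ^^ n) t) = to_circle t" for t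
    using lift_funpow[of g H n t] liftH order by simp
  then obtain c :: int where c: "\<And>t. t = (H ^^ n) t + 2 * pi * of_int c"
    by (rule lifts_differ_by_constant[OF continuous_on_funpow[OF contH]
          continuous_on_id]) (rule that, blast)
  have "(H ^^ n) t0 = t0" by (induction n) (simp_all add: H0)
  with c[of t0] have "c = 0" by simp
  then have "(H ^^ n) t = t" for t using c[of t] by simp
  then have "H t = t" for t using strict_mono_periodic_point[OF monoH] order(2) by blast
  then have "g q = q" for q using liftH by (metis circle_cases)
  then show ?thesis by auto
qed

lemma torsion_map_no_periodic_point:
  assumes "torsion_map k n f" "0 < i" "i < n"
  shows "(f ^^ i) p \<noteq> p"
proof
  assume "(f ^^ i) p = p"
  moreover have "(f ^^ i) ^^ n = id"
  proof -
    have "(f ^^ i) ^^ n = (f ^^ n) ^^ i" by (simp only: funpow_mult mult.commute)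
    moreover have "f ^^ n = id" using assms(1) by (simp only: torsion_map_def)
    ultimately show ?thesis by simp
  qed
  moreover have "orientation_preserving (f ^^ i)"
    using assms(1) orientation_preserving_funpow by (simp only: torsion_map_def)
  ultimately have "f ^^ i = id"
    using assms(2,3) finite_order_fixed_point_imp_id by (metis gr_implies_not0 neq0_conv)
  with assms show False by (simp only: torsion_map_def)
qed

lemma torsion_map_orbit_inj:
  assumes f: "torsion_map k n f"
  shows "inj_on (\<lambda>i. (f ^^ i) p) {..<n}"
proof -
  have "(f ^^ i) p \<noteq> (f ^^ j) p" if "i < j" "j < n" for i j
  proof
    assume "(f ^^ i) p = (f ^^ j) p"
    also have "\<dots> = (f ^^ i) ((f ^^ (j - i)) p)"
      using that by (metis add_diff_inverse_nat comp_apply funpow_add less_imp_not_less)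
    finally have "p = (f ^^ (j - i)) p"
      using f by (metis bij_fn bij_def injD torsion_map_def)
    then show False
      using torsion_map_no_periodic_point[OF f, of "j - i" p] that
      by (metis less_imp_diff_less zero_less_diff)
  qed
  then show ?thesis by (intro linorder_inj_onI') simp
qed

text \<open>A differentiable lift differs from an increasing one by a constant, so its derivative is
  nonnegative; a differentiable lift of the inverse map excludes zeros.\<close>

lemma torsion_map_lift:
  assumes f: "torsion_map (Suc k) n f"
  obtains F F' where "Ck (Suc k) F" "\<And>t. f (to_circle t) = to_circle (F t)"
    "\<And>t. (F has_real_derivative F' t) (at t)" "\<And>t. 0 < F' t"
proof -
  obtain F where F: "Ck (Suc k) F" "\<And>t. f (to_circle t) = to_circle (F t)"
    using f by (auto simp: torsion_map_def Ck_circle_map_def simp del: Ck.simps(2))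
  obtain G where G: "Ck (Suc k) G" "\<And>t. inv f (to_circle t) = to_circle (G t)"
    using f by (auto simp: torsion_map_def Ck_circle_map_def simp del: Ck.simps(2))
  obtain E where E: "continuous_on UNIV E" "strict_mono E" "\<And>t. f (to_circle t) = to_circle (E t)"
    using f unfolding torsion_map_def orientation_preserving_def by blast
  define F' where "F' = (\<lambda>t. vector_derivative F (at t))"
  have dF: "(F has_real_derivative F' t) (at t)" for t
    unfolding F'_def by (rule Ck_has_real_derivative[OF F(1)])
  note dG = Ck_has_real_derivative[OF G(1)]
  have "to_circle (E t) = to_circle (F t)" for t using E(3) F(2) by metis
  then obtain m :: int where "\<And>t. F t = E t + 2 * pi * of_int m"
    by (rule lifts_differ_by_constant[OF E(1) Ck_imp_continuous[OF F(1)]])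
      (rule that, blast)
  then have "mono F" using E(2) by (auto simp: strict_mono_def mono_def le_less)
  have "to_circle t = to_circle (G (F t))" for t
    using f F(2) G(2) by (metis bij_def inv_f_f torsion_map_def)
  then obtain m :: int where m: "\<And>t. G (F t) = t + 2 * pi * of_int m"
    by (rule lifts_differ_by_constant[OF continuous_on_id
          Ck_imp_continuous[OF Ck_compose[OF G(1) F(1)]]])
      (rule that, blast)
  have "0 < F' t" for t
  proof -
    have "((\<lambda>t. G (F t)) has_real_derivative vector_derivative G (at (F t)) * F' t) (at t)"
      by (rule DERIV_chain2[OF dG dF])
    moreover have "((\<lambda>t. G (F t)) has_real_derivative 1) (at t)"
      unfolding m by (auto intro!: derivative_eq_intros)
    ultimately have "vector_derivative G (at (F t)) * F' t = 1" by (rule DERIV_unique)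
    then have "F' t \<noteq> 0" by auto
    moreover have "0 \<le> F' t"
      using mono_on_imp_deriv_nonneg[of UNIV F "F' t" t] \<open>mono F\<close> dF by (simp add: mono_on_def mono_def)
    ultimately show ?thesis by simp
  qed
  with F dF show ?thesis by (rule that)
qed

section \<open>Strict convexity of simple closed curves in the plane\<close>

definition complex_of_vec :: "real^2 \<Rightarrow> complex" where
  "complex_of_vec v = Complex (v $ 1) (v $ 2)"

lemma bounded_linear_complex_of_vec: "bounded_linear complex_of_vec"
  by (rule linear_conv_bounded_linear[THEN iffD1])
    (rule linearI; simp add: complex_of_vec_def complex_eq_iff)

lemma complex_of_vec_eq_iff [simp]: "complex_of_vec v = complex_of_vec w \<longleftrightarrow> v = w"
  by (auto simp: complex_of_vec_def vec_eq_iff forall_2)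

lemma complex_of_vec_0 [simp]: "complex_of_vec 0 = 0"
  by (simp add: complex_of_vec_def complex_eq_iff)

lemma complex_of_vec_diff: "complex_of_vec (v - w) = complex_of_vec v - complex_of_vec w"
  by (simp add: complex_of_vec_def complex_eq_iff)

lemma inner_Jmat: "v \<bullet> (Jmat *v w) = v $ 2 * w $ 1 - v $ 1 * w $ 2"
  by (simp add: Jmat_def inner_vec_def matrix_vector_mult_def sum_2 algebra_simps)

lemma inner_Jmat_complex: "v \<bullet> (Jmat *v w) = Im (complex_of_vec v * cnj (complex_of_vec w))"
  by (simp add: inner_Jmat complex_of_vec_def algebra_simps)

lemma inner_Jmat_self [simp]: "v \<bullet> (Jmat *v v) = 0"
  by (simp add: inner_Jmat)

lemma inner_Jmat_eq_0_imp_parallel: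
  assumes "w \<noteq> 0" "v \<bullet> (Jmat *v w) = 0"
  obtains c where "v = c *\<^sub>R w"
proof -
  have par: "v $ 2 * w $ 1 = v $ 1 * w $ 2" using assms(2) by (simp add: inner_Jmat)
  show ?thesis
  proof (cases "w $ 1 = 0")
    case True
    with assms(1) have "w $ 2 \<noteq> 0" by (auto simp: vec_eq_iff forall_2)
    then show ?thesis using True par that[of "v $ 2 / w $ 2"] by (auto simp: vec_eq_iff forall_2)
  next
    case False
    then show ?thesis using par that[of "v $ 1 / w $ 1"] by (auto simp: vec_eq_iff forall_2 field_simps)
  qed
qed

lemma curvature_numerator_pos:
  assumes Y: "Ck_curve 2 Y" and nv: "nonvanishing_curvature Y" and pos: "positively_oriented Y"
  shows "0 < curvature_numerator Y p"
proof -
  let ?\<kappa> = "\<lambda>t. curvature_numerator Y (to_circle t)"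
  have Y2: "Ck_curve (Suc (Suc 0)) Y" using Y by (simp add: numeral_2_eq_2)
  have cont1: "continuous_on A (\<lambda>t. circle_deriv Y (to_circle t))" for A
    using Ck_imp_continuous Ck_curve_circle_deriv[OF Y2] unfolding Ck_curve_def by blast
  have cont2: "continuous_on A (\<lambda>t. circle_deriv (circle_deriv Y) (to_circle t))" for A
    using Ck_imp_continuous Ck_curve_circle_deriv[OF Ck_curve_circle_deriv[OF Y2]]
    unfolding Ck_curve_def by blast
  have cont: "continuous_on UNIV ?\<kappa>"
    unfolding curvature_numerator_def inner_Jmat by (intro continuous_intros cont1 cont2)
  have nz: "?\<kappa> t \<noteq> 0" for t using nv by (simp add: nonvanishing_curvature_def)
  have "\<exists>t. 0 < ?\<kappa> t"
  proof (rule ccontr)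
    assume "\<not> (\<exists>t. 0 < ?\<kappa> t)"
    then have le: "?\<kappa> t / (norm (circle_deriv Y (to_circle t)))\<^sup>2 \<le> 0" for t
      by (simp add: divide_nonpos_nonneg not_less)
    have "integral {0..2 * pi} (\<lambda>t. ?\<kappa> t / (norm (circle_deriv Y (to_circle t)))\<^sup>2) \<le> 0"
    proof (cases "(\<lambda>t. ?\<kappa> t / (norm (circle_deriv Y (to_circle t)))\<^sup>2) integrable_on {0..2 * pi}")
      case True then show ?thesis using integral_le[OF True integrable_0] le by simp
    next
      case False then show ?thesis by (simp add: not_integrable_integral)
    qed
    with pos show False by (simp add: positively_oriented_def)
  qed
  then obtain t1 where t1: "0 < ?\<kappa> t1" by blast
  obtain t where p: "p = to_circle t" by (rule circle_cases)
  show ?thesis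
  proof (rule ccontr)
    assume "\<not> 0 < curvature_numerator Y p"
    then have "?\<kappa> t \<le> 0" using p by simp
    moreover have "connected (range ?\<kappa>)" by (rule connected_continuous_image[OF cont connected_UNIV])
    ultimately have "0 \<in> range ?\<kappa>"
      using t1 connectedD_interval[of "range ?\<kappa>" "?\<kappa> t" "?\<kappa> t1" 0] by auto
    then show False using nz by auto
  qed
qed

lemma to_circle_in_turn:
  obtains \<tau> where "q = to_circle \<tau>" "t \<le> \<tau>" "\<tau> < t + 2 * pi"
proof -
  obtain u where u: "q = to_circle u" by (rule circle_cases)
  define i where "i = \<lfloor>(u - t) / (2 * pi)\<rfloor>"
  have "of_int i \<le> (u - t) / (2 * pi)" "(u - t) / (2 * pi) < of_int i + 1"
    unfolding i_def by linarith+
  then have "t \<le> u + 2 * pi * of_int (- i)" "u + 2 * pi * of_int (- i) < t + 2 * pi"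
    by (auto simp: field_simps)
  moreover have "q = to_circle (u + 2 * pi * of_int (- i))" unfolding to_circle_shift by (rule u)
  ultimately show ?thesis by (rule that[rotated])
qed

lemma strictly_left_of_tangent:
  assumes Y: "Ck_curve 2 Y" and reg: "\<And>p. circle_deriv Y p \<noteq> 0" and "inj Y"
    and pos: "\<And>p. 0 < curvature_numerator Y p" and "p \<noteq> q"
  shows "0 < (Y q - Y p) \<bullet> (Jmat *v circle_deriv Y p)"
proof -
  let ?y = "\<lambda>t. complex_of_vec (Y (to_circle t))"
  let ?y' = "\<lambda>t. complex_of_vec (circle_deriv Y (to_circle t))"
  let ?y'' = "\<lambda>t. complex_of_vec (circle_deriv (circle_deriv Y) (to_circle t))"
  have Y2: "Ck_curve (Suc (Suc 0)) Y" using Y by (simp add: numeral_2_eq_2)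
  note Y1 = Ck_curve_circle_deriv[OF Y2]
  note der = bounded_linear.has_vector_derivative[OF bounded_linear_complex_of_vec]
  interpret positively_curved_simple_closed_curve ?y ?y' ?y''
  proof
    fix t
    show "(?y has_vector_derivative ?y' t) (at t)"
      by (rule der[OF Ck_curve_has_vector_derivative[OF Y2]])
    show "(?y' has_vector_derivative ?y'' t) (at t)"
      by (rule der[OF Ck_curve_has_vector_derivative[OF Y1]])
    show "continuous_on UNIV ?y'"
      using Ck_imp_continuous[OF Ck_linear[OF bounded_linear_complex_of_vec Y1[unfolded Ck_curve_def]]] .
    show "?y (t + 2 * pi) = ?y t" by simp
    show "?y' t \<noteq> 0" using reg by (metis complex_of_vec_0 complex_of_vec_eq_iff)
    show "0 < Im (?y'' t * cnj (?y' t))"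
      using pos[of "to_circle t"] by (simp only: curvature_numerator_def inner_Jmat_complex)
  next
    fix s t :: real assume st: "s < t" "t < s + 2 * pi"
    show "?y s \<noteq> ?y t"
    proof
      assume "?y s = ?y t"
      then have "to_circle s = to_circle t" using \<open>inj Y\<close> by (simp add: inj_eq)
      then obtain m :: int where m: "t = s + 2 * pi * of_int m" by (auto simp: to_circle_eq_iff)
      with st have "2 * pi * 0 < 2 * pi * of_int m" "2 * pi * of_int m < 2 * pi * 1" by auto
      then have "0 < real_of_int m \<and> real_of_int m < 1"
        by (intro conjI) (erule mult_left_less_imp_less, simp)+
      then show False by auto
    qed
  qed
  obtain t where t: "p = to_circle t" by (rule circle_cases)
  obtain \<tau> where \<tau>: "q = to_circle \<tau>" "t \<le> \<tau>" "\<tau> < t + 2 * pi" by (rule to_circle_in_turn)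
  with t \<open>p \<noteq> q\<close> have "t < \<tau>" by (auto simp: le_less)
  from left_of_tangent[OF this \<tau>(3)] show ?thesis
    unfolding inner_Jmat_complex t \<tau>(1) complex_of_vec_diff .
qed

section \<open>The envelope of the chords\<close>

lemma Ck_curve_compose:
  "Ck_curve k Y \<Longrightarrow> Ck_circle_map k f \<Longrightarrow> Ck_curve k (\<lambda>p. Y (f p))"
  unfolding Ck_curve_def Ck_circle_map_def using Ck_compose by fastforce

lemma Ck_curve_chord:
  "Ck_curve k Y \<Longrightarrow> Ck_circle_map k f \<Longrightarrow> Ck_curve k (chord Y f)"
  using Ck_curve_compose[of k Y f] by (simp add: Ck_curve_def chord_def Ck_diff)

lemma Ck_inner_Jmat:
  "Ck k g \<Longrightarrow> Ck k h \<Longrightarrow> Ck k (\<lambda>t. g t \<bullet> (Jmat *v h t))"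
  by (intro Ck_bilinear[OF bounded_bilinear_inner]
      Ck_linear[OF matrix_vector_mul_bounded_linear[of Jmat]])

lemma Ck_curve_contact_param:
  assumes Y: "Ck_curve (Suc k) Y" and f: "Ck_circle_map (Suc k) f"
    and nz: "\<And>p. contact_denom Y f p \<noteq> 0"
  shows "Ck_curve k (contact_param Y f)"
proof -
  note c = Ck_curve_chord[OF Y f]
  have "Ck k (\<lambda>t. chord Y f (to_circle t))" using c by (simp add: Ck_curve_def Ck_SucD del: Ck.simps)
  then show ?thesis
    using Ck_curve_circle_deriv[OF Y] Ck_curve_circle_deriv[OF c] nz
    unfolding Ck_curve_def contact_param_def contact_denom_def divide_inverse
    by (intro Ck_linear[OF bounded_linear_minus[OF bounded_linear_ident]]
        Ck_bilinear[OF bounded_bilinear_mult] Ck_inverse Ck_inner_Jmat)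
qed

lemma Ck_curve_envelope:
  assumes Y: "Ck_curve (Suc k) Y" and f: "Ck_circle_map (Suc k) f"
    and nz: "\<And>p. contact_denom Y f p \<noteq> 0"
  shows "Ck_curve k (envelope Y f)"
  unfolding Ck_curve_def envelope_def
  by (rule Ck_add[OF Ck_SucD[OF Y[unfolded Ck_curve_def]] Ck_bilinear[OF bounded_bilinear_scaleR
        Ck_curve_contact_param[OF assms, unfolded Ck_curve_def]
        Ck_SucD[OF Ck_curve_chord[OF Y f, unfolded Ck_curve_def]]]])

text \<open>In \<open>X' = Y' + s c' + s' c\<close>, where \<open>c\<close> is the chord, the last term is parallel to the
  chord, and \<open>s\<close> is the solution of \<open>\<langle>Y' + s c', J c\<rangle> = 0\<close>.\<close>

lemma envelope_tangent_chord:
  assumes Y: "Ck_curve 2 Y" and f: "Ck_circle_map 2 f"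
    and nz: "\<And>p. contact_denom Y f p \<noteq> 0"
  shows "line_tangent_at (envelope Y f) p (Y p) (Y (f p))"
proof -
  have Y2: "Ck_curve (Suc (Suc 0)) Y" and f2: "Ck_circle_map (Suc (Suc 0)) f"
    using Y f by (simp_all add: numeral_2_eq_2)
  let ?c = "chord Y f" and ?s = "contact_param Y f"
  obtain t where p: "p = to_circle t" by (rule circle_cases)
  have ds: "((\<lambda>t. ?s (to_circle t)) has_vector_derivative circle_deriv ?s p) (at t)"
    using Ck_curve_has_vector_derivative[OF Ck_curve_contact_param[OF Y2 f2 nz]] by (simp add: p)
  have dY: "((\<lambda>t. Y (to_circle t)) has_vector_derivative circle_deriv Y p) (at t)"
    using Ck_curve_has_vector_derivative[OF Y2] by (simp add: p)
  have dc: "((\<lambda>t. ?c (to_circle t)) has_vector_derivative circle_deriv ?c p) (at t)"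
    using Ck_curve_has_vector_derivative[OF Ck_curve_chord[OF Y2 f2]] by (simp add: p)
  have X': "circle_deriv (envelope Y f) p =
      circle_deriv Y p + (?s p *\<^sub>R circle_deriv ?c p + circle_deriv ?s p *\<^sub>R ?c p)"
    unfolding p
  proof (rule circle_deriv_eqI)
    show "((\<lambda>t. envelope Y f (to_circle t)) has_vector_derivative
        circle_deriv Y (to_circle t) + (?s (to_circle t) *\<^sub>R circle_deriv ?c (to_circle t) +
          circle_deriv ?s (to_circle t) *\<^sub>R ?c (to_circle t))) (at t)"
      unfolding envelope_def
      using has_vector_derivative_add[OF dY
          bounded_bilinear.has_vector_derivative[OF bounded_bilinear_scaleR ds dc]]
      by (simp add: p)
  qed
  have "?s p * contact_denom Y f p = - (circle_deriv Y p \<bullet> (Jmat *v ?c p))"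
    using nz[of p] by (simp add: contact_param_def)
  then have "circle_deriv (envelope Y f) p \<bullet> (Jmat *v ?c p) = 0"
    by (simp add: X' inner_add_left contact_denom_def)
  moreover have "?c p \<noteq> 0" using nz[of p] by (auto simp: contact_denom_def)
  ultimately obtain a where a: "circle_deriv (envelope Y f) p = a *\<^sub>R ?c p"
    using inner_Jmat_eq_0_imp_parallel by blast
  have "envelope Y f p \<in> affine hull {Y p, Y (f p)}"
    unfolding affine_hull_2
    by (rule CollectI, rule exI[of _ "1 - ?s p"], rule exI[of _ "?s p"])
      (simp add: envelope_def chord_def algebra_simps)
  with a \<open>?c p \<noteq> 0\<close> show ?thesis by (auto simp: line_tangent_at_def chord_def)
qed

lemma poncelet_polygon_orbit:
  assumes f: "torsion_map k n f"
    and tangent: "\<And>p. line_tangent_at X p (Y p) (Y (f p))"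
  shows "poncelet_polygon n Y X (\<lambda>i. (f ^^ i) p)"
  unfolding poncelet_polygon_def
proof (intro conjI allI impI)
  fix i assume "i < n"
  then have "(f ^^ (Suc i mod n)) p = f ((f ^^ i) p)"
    using f by (cases "Suc i = n") (auto simp: torsion_map_def dest: fun_cong[of _ _ p])
  then show "\<exists>q. line_tangent_at X q (Y ((f ^^ i) p)) (Y ((f ^^ (Suc i mod n)) p))"
    using tangent by metis
qed (rule torsion_map_orbit_inj[OF f])

text \<open>Write \<open>a = - \<langle>Y', J c\<rangle>\<close> for the chord \<open>c\<close> from \<open>Y\<close>, and \<open>b\<close> for the value of
  \<open>\<langle>Y', J c\<rangle>\<close> with the derivative taken at the other end. Strict convexity makes both positive, and
  \<open>s = a / (a + F' b)\<close>, where \<open>F\<close> is a lift of \<open>f\<close>.\<close>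

lemma contact_inside_chord:
  assumes Y: "Ck_curve 2 Y" and f: "torsion_map 2 n f" and "2 \<le> n"
    and left: "\<And>p q. p \<noteq> q \<Longrightarrow> 0 < (Y q - Y p) \<bullet> (Jmat *v circle_deriv Y p)"
  shows "contact_denom Y f p \<noteq> 0" "0 < contact_param Y f p" "contact_param Y f p < 1"
proof -
  have Y2: "Ck_curve (Suc (Suc 0)) Y" and f2: "torsion_map (Suc (Suc 0)) n f"
    using Y f by (simp_all add: numeral_2_eq_2)
  obtain F F' where F: "\<And>t. f (to_circle t) = to_circle (F t)"
    and dF: "\<And>t. (F has_real_derivative F' t) (at t)" and F'pos: "\<And>t. 0 < F' t"
    by (rule torsion_map_lift[OF f2]) (rule that, blast+)
  obtain t where p: "p = to_circle t" by (rule circle_cases)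
  let ?c = "chord Y f p"
  define a where "a = - (circle_deriv Y p \<bullet> (Jmat *v ?c))"
  define b where "b = circle_deriv Y (f p) \<bullet> (Jmat *v ?c)"
  have "f p \<noteq> p" using torsion_map_no_periodic_point[OF f, of 1 p] \<open>2 \<le> n\<close> by simp
  then have "0 < a" "0 < b"
    using left[of p "f p"] left[of "f p" p]
    by (simp_all add: a_def b_def chord_def inner_Jmat algebra_simps)
  have "((\<lambda>u. Y (to_circle (F u)) - Y (to_circle u)) has_vector_derivative
      F' t *\<^sub>R circle_deriv Y (to_circle (F t)) - circle_deriv Y (to_circle t)) (at t)"
    using vector_diff_chain_at[of F "F' t" t, OF _ Ck_curve_has_vector_derivative[OF Y2]]
      dF[of t] Ck_curve_has_vector_derivative[OF Y2, of t]
    by (intro has_vector_derivative_diff)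
      (simp_all add: o_def has_real_derivative_iff_has_vector_derivative)
  then have "circle_deriv (chord Y f) p = F' t *\<^sub>R circle_deriv Y (f p) - circle_deriv Y p"
    unfolding p F by (intro circle_deriv_eqI) (simp add: chord_def F)
  then have denom: "contact_denom Y f p = F' t * b + a"
    by (simp add: contact_denom_def a_def b_def inner_diff_left)
  have "0 < F' t * b" using F'pos[of t] \<open>0 < b\<close> by simp
  moreover have param: "contact_param Y f p = a / contact_denom Y f p"
    by (simp add: contact_param_def a_def)
  ultimately show "contact_denom Y f p \<noteq> 0" "0 < contact_param Y f p" "contact_param Y f p < 1"
    using \<open>0 < a\<close> by (simp_all add: denom)
qed

lemma envelope_in_open_segment:
  assumes "contact_denom Y f p \<noteq> 0" "0 < contact_param Y f p" "contact_param Y f p < 1"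
  shows "envelope Y f p \<in> open_segment (Y p) (Y (f p))"
proof -
  have "Y p \<noteq> Y (f p)" using assms(1) by (auto simp: contact_denom_def chord_def)
  then show ?thesis
    unfolding in_segment using assms
    by (intro conjI exI[of _ "contact_param Y f p"]) (auto simp: envelope_def chord_def algebra_simps)
qed

lemma Ck_circle_map_mono: "Ck_circle_map k f \<Longrightarrow> j \<le> k \<Longrightarrow> Ck_circle_map j f"
  unfolding Ck_circle_map_def using Ck_mono by blast

lemma torsion_map_Ck_mono: "torsion_map k n f \<Longrightarrow> j \<le> k \<Longrightarrow> torsion_map j n f"
  unfolding torsion_map_def using Ck_circle_map_mono by blast

lemma Ck_curve_mono: "Ck_curve k Y \<Longrightarrow> j \<le> k \<Longrightarrow> Ck_curve j Y"
  unfolding Ck_curve_def by (rule Ck_mono)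

theorem theorem15:
  fixes Y :: "circle \<Rightarrow> real^2" and f :: "circle \<Rightarrow> circle" and k n :: nat
  assumes "k \<ge> 2" and "n \<ge> 2"
    and "regular_curve k Y" and "positively_oriented Y" and "nonvanishing_curvature Y"
    and "torsion_map k n f"
  shows
    "((\<forall>p. contact_denom Y f p \<noteq> 0) \<longrightarrow>
        Ck_curve (k - 1) (envelope Y f) \<and>
        poncelet_pair n Y (envelope Y f) \<and>
        (\<forall>p. poncelet_polygon n Y (envelope Y f) (\<lambda>i. (f ^^ i) p)) \<and>
        (\<forall>p. line_tangent_at (envelope Y f) p (Y p) (Y (f p)))) \<and>
     ((\<forall>p. contact_denom Y f p \<noteq> 0) \<and> k \<ge> 3 \<and> nonvanishing_curvature (envelope Y f) \<longrightarrow>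
        regular_curve (k - 1) (envelope Y f)) \<and>
     (inj Y \<longrightarrow>
        (\<forall>p. contact_denom Y f p \<noteq> 0 \<and>
             0 < contact_param Y f p \<and> contact_param Y f p < 1 \<and>
             envelope Y f p \<in> open_segment (Y p) (Y (f p))))"
proof -
  have Y: "Ck_curve k Y" and reg: "\<And>p. circle_deriv Y p \<noteq> 0"
    using assms(3) by (auto simp: regular_curve_def)
  have f: "Ck_circle_map k f" using assms(6) by (simp add: torsion_map_def)
  have Y2: "Ck_curve 2 Y" and f2: "Ck_circle_map 2 f" and t2: "torsion_map 2 n f"
    using Y f assms(1,6) Ck_curve_mono Ck_circle_map_mono torsion_map_Ck_mono by blast+
  have smooth: "Ck_curve (k - 1) (envelope Y f)" if "\<forall>p. contact_denom Y f p \<noteq> 0"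
    using Ck_curve_envelope[of "k - 1" Y f] Y f that assms(1) by simp
  have item1: "Ck_curve (k - 1) (envelope Y f) \<and>
        poncelet_pair n Y (envelope Y f) \<and>
        (\<forall>p. poncelet_polygon n Y (envelope Y f) (\<lambda>i. (f ^^ i) p)) \<and>
        (\<forall>p. line_tangent_at (envelope Y f) p (Y p) (Y (f p)))"
    if nz: "\<forall>p. contact_denom Y f p \<noteq> 0"
  proof -
    have tangent: "line_tangent_at (envelope Y f) p (Y p) (Y (f p))" for p
      using envelope_tangent_chord[OF Y2 f2] nz by blast
    have polygon: "poncelet_polygon n Y (envelope Y f) (\<lambda>i. (f ^^ i) p)" for p
      by (rule poncelet_polygon_orbit[OF assms(6) tangent])
    have "\<exists>q. poncelet_polygon n Y (envelope Y f) q \<and> (\<exists>i<n. Y (q i) = Y p)" for p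
      using polygon[of p] assms(2) by (intro exI[of _ "\<lambda>i. (f ^^ i) p"] conjI exI[of _ 0]) auto
    moreover have "Ck_curve 1 Y" "Ck_curve 1 (envelope Y f)"
      using Ck_curve_mono[OF Y, of 1] Ck_curve_mono[OF smooth[OF nz], of 1] assms(1) by auto
    ultimately show ?thesis
      using tangent polygon smooth[OF nz] by (auto simp: poncelet_pair_def)
  qed
  \<comment> \<open>The curvature numerator vanishes wherever the first derivative does.\<close>
  have item2: "regular_curve (k - 1) (envelope Y f)"
    if "\<forall>p. contact_denom Y f p \<noteq> 0" "nonvanishing_curvature (envelope Y f)"
    using that smooth
    unfolding regular_curve_def nonvanishing_curvature_def curvature_numerator_def
    by (metis inner_zero_right matrix_vector_mult_0_right)
  have item3: "contact_denom Y f p \<noteq> 0 \<and> 0 < contact_param Y f p \<and> contact_param Y f p < 1 \<and>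
      envelope Y f p \<in> open_segment (Y p) (Y (f p))" if "inj Y" for p
  proof -
    have "0 < (Y q - Y p) \<bullet> (Jmat *v circle_deriv Y p)" if "p \<noteq> q" for p q
      by (rule strictly_left_of_tangent[OF Y2 reg \<open>inj Y\<close>
            curvature_numerator_pos[OF Y2 assms(5,4)] that])
    from contact_inside_chord[OF Y2 t2 assms(2) this] show ?thesis
      using envelope_in_open_segment by blast
  qed
  show ?thesis using item1 item2 item3 by blast
qed

end
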